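(* Let $\mathcal M$ be a non-cyclic $n$-dimensional subspace of $\mathcal H$ (with $\mathcal M\subseteq M_k$ for some $k\in\mathbb N$) that is invariant under $T^{*2}$, where $T^*$ is the backward shift with all weights equal to $1$ on $M_k$. Then $$\mathcal M=\operatorname{span}\{e_0,\ldots,e_{n-p-2},\,T^{*2p}x,\ldots,x\},$$ where $x\in\mathcal M$ is such that $\langle x,e_{n+p}\rangle\neq 0$ for some $-1\le p\le n-3$.
   Context: $\mathbb N=\{0,1,2,\ldots\}$. $\mathcal H$ is a separable complex Hilbert space with orthonormal basis $\{e_n\}_{n\in\mathbb N}$, and $M_k=\operatorname{span}\{e_0,\ldots,e_k\}$. $T^*:M_k\to M_k$ is the backward shift with all weights equal to $1$: $T^*e_0=0$ and $T^*e_i=e_{i-1}$ for $1\le i\le k$. $T^{*r}$ denotes $(T^* )^r$. The list $T^{*2p}x,\ldots,x$ means $T^{*2p}x,T^{*2(p-1)}x,\ldots,T^{*2}x,x$, and is empty when $p=-1$. A $T^{*2}$-invariant subspace $\mathcal M\subseteq M_k$ is cyclic if $\mathcal M=\operatorname{span}\{T^{*2i}x:i\ge0\}$ for some $x\in\mathcal M$, and non-cyclic otherwise. *)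

theory Defs
  imports "HOL-Analysis.Analysis"
begin

text \<open>
  Complex Hilbert spaces, as Banach spaces whose scalar multiplication extends to the complex
  numbers and whose norm comes from a complex inner product. The inner product is linear in its
  first argument.
\<close>

class complex_hilbert_space = banach +
  fixes scaleC :: "complex \<Rightarrow> 'a \<Rightarrow> 'a" (infixr "*\<^sub>C" 75)
    and cinner :: "'a \<Rightarrow> 'a \<Rightarrow> complex"
  assumes scaleC_add_right: "c *\<^sub>C (x + y) = c *\<^sub>C x + c *\<^sub>C y"
    and scaleC_add_left: "(c + d) *\<^sub>C x = c *\<^sub>C x + d *\<^sub>C x"
    and scaleC_scaleC: "c *\<^sub>C d *\<^sub>C x = (c * d) *\<^sub>C x"
    and scaleC_of_real: "complex_of_real r *\<^sub>C x = r *\<^sub>R x"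
    and cinner_commute: "cinner x y = cnj (cinner y x)"
    and cinner_add_left: "cinner (x + y) z = cinner x z + cinner y z"
    and cinner_scaleC_left: "cinner (c *\<^sub>C x) y = c * cinner x y"
    and cinner_self: "cinner x x = complex_of_real ((norm x)\<^sup>2)"

global_interpretation complex_vector: vector_space
    "scaleC :: complex \<Rightarrow> 'a \<Rightarrow> 'a :: complex_hilbert_space"
  defines cspan = complex_vector.span
    and csubspace = complex_vector.subspace
    and cdim = complex_vector.dim
proof
  show "1 *\<^sub>C x = x" for x :: 'a
    using scaleC_of_real[of 1 x] by simp
qed (simp_all add: scaleC_add_right scaleC_add_left scaleC_scaleC)

text \<open>
  An orthonormal basis indexed by \<open>\<nat>\<close>. Its existence makes the space separable and infinite
  dimensional, so separability is not assumed separately.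
\<close>

definition orthonormal_basis :: "(nat \<Rightarrow> 'a :: complex_hilbert_space) \<Rightarrow> bool" where
  "orthonormal_basis e \<longleftrightarrow>
     (\<forall>i j. cinner (e i) (e j) = (if i = j then 1 else 0)) \<and>
     closure (cspan (range e)) = UNIV"

definition M_space :: "(nat \<Rightarrow> 'a :: complex_hilbert_space) \<Rightarrow> nat \<Rightarrow> 'a set" where
  "M_space e k = cspan (e ` {..k})"

text \<open>
  \<open>T\<close> is the linear map on \<open>M_space e k\<close> that is the backward shift with unit weights.
  Nothing is required of \<open>T\<close> outside \<open>M_space e k\<close>.
\<close>

definition backward_shift_on ::
    "(nat \<Rightarrow> 'a :: complex_hilbert_space) \<Rightarrow> nat \<Rightarrow> ('a \<Rightarrow> 'a) \<Rightarrow> bool" where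
  "backward_shift_on e k T \<longleftrightarrow>
     T ` M_space e k \<subseteq> M_space e k \<and>
     (\<forall>x \<in> M_space e k. \<forall>y \<in> M_space e k. T (x + y) = T x + T y) \<and>
     (\<forall>c. \<forall>x \<in> M_space e k. T (c *\<^sub>C x) = c *\<^sub>C T x) \<and>
     T (e 0) = 0 \<and>
     (\<forall>i. 1 \<le> i \<and> i \<le> k \<longrightarrow> T (e i) = e (i - 1))"

definition cyclic_subspace ::
    "('a :: complex_hilbert_space \<Rightarrow> 'a) \<Rightarrow> 'a set \<Rightarrow> bool" where
  "cyclic_subspace T M \<longleftrightarrow> (\<exists>x \<in> M. M = cspan (range (\<lambda>i. (T ^^ (2 * i)) x)))"

end

theory Submission
  imports Defs
begin

text \<open>
  Measure a vector of \<open>M_space e k\<close> by its degree, the largest index of a nonzero coordinate; the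
  square of \<open>T\<close> lowers degrees by two. Let \<open>q\<close> be the first index with \<open>e q \<notin> M\<close>. No vector of \<open>M\<close>
  has degree \<open>q + 2 * j\<close>, as applying \<open>T\<close> to it \<open>2 * j\<close> times would give \<open>e q \<in> M\<close>. So all degrees
  that are at least \<open>q\<close> lie in \<open>{q + 1, q + 3, \<dots>}\<close>, and if \<open>x \<in> M\<close> has the maximal one,
  \<open>q + 2 * r - 1\<close>, then \<open>e 0, \<dots>, e (q - 1)\<close> and \<open>x, (T ^^ 2) x, \<dots>, (T ^^ (2 * (r - 1))) x\<close> form a
  basis of \<open>M\<close> by elimination of leading terms. Hence \<open>n = q + r\<close> and \<open>p = r - 1\<close>. If \<open>q \<le> 1\<close>, then
  \<open>M\<close> is cyclic: for \<open>q = 1\<close>, the vector \<open>(T ^^ (2 * r)) x\<close> is a nonzero multiple of \<open>e 0\<close>.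
\<close>

locale backward_shift =
  fixes e :: "nat \<Rightarrow> 'h :: complex_hilbert_space" and T :: "'h \<Rightarrow> 'h" and k :: nat
  assumes orthonormal: "cinner (e i) (e j) = (if i = j then 1 else 0)"
    and shift: "backward_shift_on e k T"
begin

section \<open>Coordinates in \<open>M_space e k\<close> and the effect of the shift on them\<close>

abbreviation coord :: "'h \<Rightarrow> nat \<Rightarrow> complex" where
  "coord x i \<equiv> cinner x (e i)"

lemma coord_zero [simp]: "coord 0 i = 0"
  using cinner_scaleC_left[of 0 0 "e i"] by simp

lemma coord_diff: "coord (x - y) i = coord x i - coord y i"
  using cinner_add_left[of "x - y" y "e i"] by simp

lemma coord_sum: "coord (sum f A) i = (\<Sum>a\<in>A. coord (f a) i)"
  by (induction A rule: infinite_finite_induct) (auto simp: cinner_add_left)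

lemma subspace_M_space: "csubspace (M_space e k)"
  by (simp add: M_space_def)

lemma T_in_M_space: "x \<in> M_space e k \<Longrightarrow> T x \<in> M_space e k"
  using shift by (auto simp: backward_shift_on_def)

lemma T_zero [simp]: "T 0 = 0"
proof -
  have "T (0 *\<^sub>C 0) = 0 *\<^sub>C T 0"
    using shift complex_vector.subspace_0[OF subspace_M_space]
    unfolding backward_shift_on_def by blast
  then show ?thesis by simp
qed

text \<open>The fixed vectors of the linear map \<open>?P\<close> form a subspace, and this subspace
  contains every \<open>e j\<close> with \<open>j \<le> k\<close>.\<close>

lemma M_space_expansion:
  assumes "x \<in> M_space e k"
  shows "x = (\<Sum>i\<le>k. coord x i *\<^sub>C e i)"
proof -
  let ?P = "\<lambda>x. \<Sum>i\<le>k. coord x i *\<^sub>C e i"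
  have "?P (x + y) = ?P x + ?P y" for x y
    by (simp add: cinner_add_left scaleC_add_left sum.distrib)
  moreover have "?P (c *\<^sub>C x) = c *\<^sub>C ?P x" for c x
    by (simp add: cinner_scaleC_left complex_vector.scale_sum_right)
  ultimately have "csubspace {x. x = ?P x}"
    by (intro complex_vector.subspaceI) (simp_all only: mem_Collect_eq, simp_all)
  moreover have "e j = ?P (e j)" if "j \<le> k" for j
  proof -
    have "?P (e j) = (\<Sum>i\<le>k. if j = i then e i else 0)"
      by (rule sum.cong) (auto simp: orthonormal)
    then show ?thesis using that by simp
  qed
  ultimately show ?thesis
    using complex_vector.span_minimal[of "e ` {..k}" "{x. x = ?P x}"] assms
    unfolding M_space_def by blast
qed

lemma coord_eq_0_of_gt:
  assumes "x \<in> M_space e k" "i > k"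
  shows "coord x i = 0"
proof -
  have "coord x i = (\<Sum>j\<le>k. coord x j * coord (e j) i)"
    by (subst M_space_expansion[OF assms(1)]) (simp add: coord_sum cinner_scaleC_left)
  also have "\<dots> = 0"
    using assms(2) by (intro sum.neutral) (auto simp: orthonormal)
  finally show ?thesis .
qed

lemma in_span_of_coords:
  assumes "x \<in> M_space e k" "\<And>i. i \<ge> q \<Longrightarrow> coord x i = 0"
  shows "x \<in> cspan (e ` {..<q})"
proof -
  have "coord x i *\<^sub>C e i \<in> cspan (e ` {..<q})" for i
    using assms(2)[of i]
    by (cases "i < q")
      (auto intro!: complex_vector.span_scale intro: complex_vector.span_base
        complex_vector.span_zero)
  then have "(\<Sum>i\<le>k. coord x i *\<^sub>C e i) \<in> cspan (e ` {..<q})"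
    by (intro complex_vector.span_sum) auto
  then show ?thesis by (subst M_space_expansion[OF assms(1)])
qed

lemma coord_T:
  assumes "x \<in> M_space e k"
  shows "coord (T x) i = coord x (Suc i)"
proof -
  \<comment> \<open>Membership in \<open>M_space e k\<close> is built into \<open>?A\<close> because
    linearity of \<open>T\<close> is assumed only there.\<close>
  let ?A = "{x \<in> M_space e k. coord (T x) i = coord x (Suc i)}"
  have "csubspace ?A"
    using shift subspace_M_space
    by (intro complex_vector.subspaceI)
      (auto simp: backward_shift_on_def cinner_add_left cinner_scaleC_left
        complex_vector.subspace_0 complex_vector.subspace_add complex_vector.subspace_scale)
  moreover have "e j \<in> ?A" if "j \<le> k" for j
    using that shift
    by (cases j) (auto simp: backward_shift_on_def orthonormal M_space_def
        intro: complex_vector.span_base)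
  ultimately have "cspan (e ` {..k}) \<subseteq> ?A"
    by (intro complex_vector.span_minimal) auto
  then show ?thesis using assms unfolding M_space_def by auto
qed

lemma T_funpow:
  assumes "x \<in> M_space e k"
  shows "(T ^^ m) x \<in> M_space e k" and "coord ((T ^^ m) x) i = coord x (i + m)"
proof -
  show *: "(T ^^ m) x \<in> M_space e k" for m
    by (induction m) (use assms T_in_M_space in auto)
  show "coord ((T ^^ m) x) i = coord x (i + m)"
    by (induction m arbitrary: i) (simp_all add: coord_T *)
qed

section \<open>Leading terms and degrees of vectors in a subspace\<close>

lemma basis_vector_mem:
  assumes "csubspace M" "M \<subseteq> M_space e k" "y \<in> M"
    and "coord y d \<noteq> 0" "\<And>i. i > d \<Longrightarrow> coord y i = 0"
    and "e ` {..<d} \<subseteq> M"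
  shows "e d \<in> M"
proof -
  have y: "y \<in> M_space e k" using assms by auto
  then have "d \<le> k" using coord_eq_0_of_gt assms(4) by (meson not_le)
  then have ed: "e d \<in> M_space e k"
    by (auto simp: M_space_def intro: complex_vector.span_base)
  \<comment> \<open>Without its leading term, \<open>y\<close> becomes a combination of
    \<open>e 0, ..., e (d - 1)\<close>, all of which lie in \<open>M\<close>.\<close>
  let ?w = "y - coord y d *\<^sub>C e d"
  have "?w \<in> cspan (e ` {..<d})"
  proof (rule in_span_of_coords)
    show "?w \<in> M_space e k"
      using y ed subspace_M_space
      by (simp add: complex_vector.subspace_diff complex_vector.subspace_scale)
    show "coord ?w i = 0" if "i \<ge> d" for i
      using that assms(5)[of i]
      by (cases "i = d") (auto simp: coord_diff cinner_scaleC_left orthonormal)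
  qed
  then have "?w \<in> M"
    using complex_vector.span_minimal[OF assms(6,1)] by auto
  then have "y - ?w \<in> M" using assms(1,3) complex_vector.subspace_diff by blast
  then have "inverse (coord y d) *\<^sub>C coord y d *\<^sub>C e d \<in> M"
    using assms(1) complex_vector.subspace_scale by fastforce
  then show ?thesis using assms(4) by simp
qed

lemma funpow_mem:
  assumes "(T ^^ 2) ` M \<subseteq> M" "x \<in> M"
  shows "(T ^^ (2 * i)) x \<in> M"
proof (induction i)
  case (Suc i)
  have "(T ^^ 2) ((T ^^ (2 * i)) x) \<in> M" using Suc assms by auto
  then show ?case by (simp add: numeral_2_eq_2)
qed (use assms in simp)

lemma degree_parity:
  assumes "csubspace M" "M \<subseteq> M_space e k" "(T ^^ 2) ` M \<subseteq> M"
    and "e ` {..<q} \<subseteq> M" "e q \<notin> M"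
    and "y \<in> M" "coord y d \<noteq> 0" "\<And>i. i > d \<Longrightarrow> coord y i = 0" "d \<ge> q"
  obtains j where "d = q + 2 * j + 1"
proof -
  have "d \<noteq> q + 2 * j" for j
  proof
    assume d: "d = q + 2 * j"
    have y: "y \<in> M_space e k" using assms by auto
    \<comment> \<open>Shifting \<open>2 * j\<close> times moves the leading term of \<open>y\<close>
      from index \<open>d\<close> to index \<open>q\<close>.\<close>
    have "e q \<in> M"
      by (rule basis_vector_mem[where y = "(T ^^ (2 * j)) y"])
        (use assms d y in \<open>auto simp: T_funpow funpow_mem\<close>)
    then show False using assms by simp
  qed
  moreover have "d = q + 2 * ((d - q) div 2) \<or> d = q + 2 * ((d - q) div 2) + 1"
    using assms(9) by presburger
  ultimately show ?thesis using that by metis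
qed

text \<open>The coordinates form a triangular array with pivots \<open>deg i\<close>: all vectors
  before \<open>b N\<close> vanish at coordinate \<open>deg N\<close>, while \<open>b N\<close> does
  not, so \<open>b N\<close> lies outside their span. The cardinality records that \<open>b\<close>
  does not repeat, as needed to read off a dimension.\<close>

lemma independent_of_degrees:
  assumes "\<And>i. i < N \<Longrightarrow> coord (b i) (deg i) \<noteq> 0"
    and "\<And>i j. i < j \<Longrightarrow> j < N \<Longrightarrow> coord (b i) (deg j) = 0"
  shows "complex_vector.independent (b ` {..<N}) \<and> card (b ` {..<N}) = N"
  using assms
proof (induction N)
  case 0
  then show ?case by (simp add: complex_vector.independent_empty)
next
  case (Suc N)
  have IH: "complex_vector.independent (b ` {..<N})" "card (b ` {..<N}) = N"
    using Suc by auto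
  have "csubspace {x. coord x (deg N) = 0}"
    by (rule complex_vector.subspaceI) (auto simp: cinner_add_left cinner_scaleC_left)
  then have "cspan (b ` {..<N}) \<subseteq> {x. coord x (deg N) = 0}"
    by (intro complex_vector.span_minimal) (use Suc.prems(2) in auto)
  then have notin: "b N \<notin> cspan (b ` {..<N})" using Suc.prems(1)[of N] by auto
  then have "b N \<notin> b ` {..<N}" by (meson complex_vector.span_base)
  then show ?case
    using IH notin by (simp add: lessThan_Suc complex_vector.independent_insert)
qed

section \<open>Generators and dimension of an invariant subspace\<close>

lemma invariant_subspace_structure:
  assumes "csubspace M" "M \<subseteq> M_space e k" "(T ^^ 2) ` M \<subseteq> M"
    and "e ` {..<q} \<subseteq> M" "e q \<notin> M"
  obtains x r where "x \<in> M" "r > 0 \<Longrightarrow> coord x (q + 2 * r - 1) \<noteq> 0"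
    and "\<And>i. i \<ge> q + 2 * r \<Longrightarrow> coord x i = 0"
    and "M = cspan (e ` {..<q} \<union> (\<lambda>i. (T ^^ (2 * i)) x) ` {..<r})"
    and "cdim M = q + r"
proof -
  let ?gen = "\<lambda>x r. e ` {..<q} \<union> (\<lambda>i. (T ^^ (2 * i)) x) ` {..<r}"
  obtain x r where x: "x \<in> M" and lead: "r > 0 \<Longrightarrow> coord x (q + 2 * r - 1) \<noteq> 0"
    and top: "\<And>y i. y \<in> M \<Longrightarrow> i \<ge> q + 2 * r \<Longrightarrow> coord y i = 0"
  proof (cases "\<exists>d\<ge>q. \<exists>y\<in>M. coord y d \<noteq> 0")
    \<comment> \<open>All degrees are below \<open>q\<close>, so no shifts are needed:
      \<open>r = 0\<close> and \<open>x = 0\<close> serve.\<close>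
    case False
    with that[of 0 0] assms(1) show ?thesis by (simp add: complex_vector.subspace_0)
  next
    case True
    let ?P = "\<lambda>d. d \<ge> q \<and> (\<exists>y\<in>M. coord y d \<noteq> 0)"
    \<comment> \<open>The maximal degree on \<open>M\<close>; it exists since coordinates beyond
      \<open>k\<close> vanish.\<close>
    define d where "d = Greatest ?P"
    have bound: "i \<le> k" if "?P i" for i
      using that assms(2) coord_eq_0_of_gt by (meson in_mono not_le)
    have d: "?P d"
      unfolding d_def by (rule GreatestI_ex_nat[of ?P k]) (use True bound in auto)
    have max: "i \<le> d" if "?P i" for i
      unfolding d_def by (rule Greatest_le_nat[of ?P _ k]) (use that bound in auto)
    obtain x where x: "x \<in> M" "coord x d \<noteq> 0" using d by auto
    have zero: "coord y i = 0" if "y \<in> M" "i > d" for y i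
      using max[of i] that d by force
    \<comment> \<open>By parity, \<open>d = q + 2 * r - 1\<close> with
      \<open>r = Suc j\<close>.\<close>
    obtain j where "d = q + 2 * j + 1"
      using degree_parity[OF assms x(1,2)] zero x d by blast
    with that[of x "Suc j"] x zero show ?thesis by auto
  qed
  have xk: "x \<in> M_space e k" using x assms by auto
  \<comment> \<open>Elimination of leading terms, by induction on a strict upper bound
    \<open>N\<close> for the degree.\<close>
  have "y \<in> cspan (?gen x r)" if "y \<in> M" "\<And>i. i \<ge> N \<Longrightarrow> coord y i = 0" for y N
    using that
  proof (induction N arbitrary: y)
    case 0
    have "y \<in> cspan (e ` {..<0})"
      by (rule in_span_of_coords) (use 0 assms in auto)
    then show ?case by (simp add: complex_vector.span_zero)
  next
    case (Suc N)
    consider "coord y N = 0" | "N < q" | "coord y N \<noteq> 0" "N \<ge> q" by fastforce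
    then show ?case
    proof cases
      case 1
      have "coord y i = 0" if "i \<ge> N" for i
        using that 1 Suc.prems(2)[of i] by (cases "i = N") auto
      then show ?thesis using Suc by blast
    next
      case 2
      have "y \<in> cspan (e ` {..<q})"
        by (rule in_span_of_coords) (use Suc.prems assms 2 in auto)
      then show ?thesis using complex_vector.span_mono[of "e ` {..<q}" "?gen x r"] by auto
    next
      case 3
      obtain j where j: "N = q + 2 * j + 1"
        using degree_parity[OF assms Suc.prems(1) 3(1) _ 3(2)] Suc.prems(2) by auto
      have "j < r" using top[OF Suc.prems(1), of N] 3 j by linarith
      \<comment> \<open>The number of shifts is chosen to bring the degree
        \<open>q + 2 * r - 1\<close> of \<open>x\<close> down to \<open>N\<close>, so that a
        multiple of \<open>z\<close> cancels the leading term of \<open>y\<close>.\<close>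
      define z where "z = (T ^^ (2 * (r - 1 - j))) x"
      have z: "z \<in> M" using x assms funpow_mem by (simp add: z_def)
      have zgen: "z \<in> cspan (?gen x r)"
        using \<open>j < r\<close> by (auto simp: z_def intro!: complex_vector.span_base)
      have idx: "N + 2 * (r - 1 - j) = q + 2 * r - 1" using j \<open>j < r\<close> by linarith
      then have zN: "coord z N \<noteq> 0" using lead \<open>j < r\<close> by (simp add: z_def T_funpow xk)
      have zi: "coord z i = 0" if "i > N" for i
        using that idx top[OF x] by (simp add: z_def T_funpow xk)
      let ?c = "coord y N / coord z N"
      have "y - ?c *\<^sub>C z \<in> cspan (?gen x r)"
      proof (rule Suc.IH)
        show "y - ?c *\<^sub>C z \<in> M"
          using Suc.prems z assms(1)
          by (simp add: complex_vector.subspace_diff complex_vector.subspace_scale)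
        show "coord (y - ?c *\<^sub>C z) i = 0" if "i \<ge> N" for i
          using that zN zi Suc.prems(2)[of i]
          by (cases "i = N") (auto simp: coord_diff cinner_scaleC_left)
      qed
      then have "(y - ?c *\<^sub>C z) + ?c *\<^sub>C z \<in> cspan (?gen x r)"
        using zgen by (intro complex_vector.span_add complex_vector.span_scale)
      then show ?thesis by simp
    qed
  qed
  then have "M \<subseteq> cspan (?gen x r)"
    using top by blast
  moreover have "cspan (?gen x r) \<subseteq> M"
    using assms x funpow_mem by (intro complex_vector.span_minimal) auto
  ultimately have M: "M = cspan (?gen x r)" by blast
  \<comment> \<open>The generators in order of increasing degree, hence with the shifts of
    \<open>x\<close> reversed; for \<open>i < q + r\<close>, the degree of \<open>b i\<close> is
    \<open>deg i\<close>.\<close>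
  define b where "b i = (if i < q then e i else (T ^^ (2 * (r - 1 - (i - q)))) x)" for i
  define deg where "deg i = (if i < q then i else q + 2 * (i - q) + 1)" for i
  have coord_b: "coord (b i) m = coord x (m + 2 * (r - 1 - (i - q)))" if "i \<ge> q" for i m
    using that xk by (simp add: b_def T_funpow)
  have gen: "?gen x r = b ` {..<q + r}"
  proof -
    have "(\<lambda>i. (T ^^ (2 * i)) x) ` {..<r} = b ` {q..<q + r}"
    proof (intro equalityI subsetI)
      fix v assume "v \<in> (\<lambda>i. (T ^^ (2 * i)) x) ` {..<r}"
      then obtain i where "i < r" "v = (T ^^ (2 * i)) x" by auto
      then show "v \<in> b ` {q..<q + r}"
        by (intro image_eqI[of _ _ "q + (r - 1 - i)"]) (auto simp: b_def)
    next
      fix v assume "v \<in> b ` {q..<q + r}"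
      then show "v \<in> (\<lambda>i. (T ^^ (2 * i)) x) ` {..<r}" by (auto simp: b_def)
    qed
    moreover have "e ` {..<q} = b ` {..<q}" by (auto simp: b_def)
    ultimately show ?thesis
      by (simp add: image_Un[symmetric] ivl_disj_un)
  qed
  have "complex_vector.independent (b ` {..<q + r}) \<and> card (b ` {..<q + r}) = q + r"
  proof (rule independent_of_degrees[where deg = deg])
    fix i assume i: "i < q + r"
    show "coord (b i) (deg i) \<noteq> 0"
    proof (cases "i < q")
      case False
      then have "deg i + 2 * (r - 1 - (i - q)) = q + 2 * r - 1"
        using i unfolding deg_def by auto
      then show ?thesis using False i lead by (simp add: coord_b)
    qed (simp add: b_def deg_def orthonormal)
  next
    fix i j assume ij: "i < j" "j < q + r"
    show "coord (b i) (deg j) = 0"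
    proof (cases "i < q")
      case False
      then have "deg j + 2 * (r - 1 - (i - q)) \<ge> q + 2 * r"
        using ij unfolding deg_def by auto
      then show ?thesis using False top[OF x] by (simp add: coord_b)
    qed (use ij in \<open>auto simp: b_def deg_def orthonormal\<close>)
  qed
  then have "cdim M = q + r"
    unfolding M gen complex_vector.dim_span using complex_vector.dim_eq_card_independent by metis
  with that[of x r] x lead top[OF x] M show ?thesis by blast
qed

text \<open>For \<open>q = 0\<close> the generators found above are already shifts of one vector.
  For \<open>q = 1\<close> the only other generator is \<open>e 0\<close>, which one further double
  shift of \<open>x\<close> recovers up to a factor when \<open>r > 0\<close>.\<close>

lemma cyclic_of_small_gap:
  assumes "csubspace M" "M \<subseteq> M_space e k" "(T ^^ 2) ` M \<subseteq> M"
    and "e ` {..<q} \<subseteq> M" "e q \<notin> M" "q \<le> 1"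
  shows "cyclic_subspace T M"
proof -
  obtain x r where x: "x \<in> M" and lead: "r > 0 \<Longrightarrow> coord x (q + 2 * r - 1) \<noteq> 0"
    and top: "\<And>i. i \<ge> q + 2 * r \<Longrightarrow> coord x i = 0"
    and M: "M = cspan (e ` {..<q} \<union> (\<lambda>i. (T ^^ (2 * i)) x) ` {..<r})"
    using invariant_subspace_structure[OF assms(1-5)] by metis
  \<comment> \<open>If \<open>r = 0\<close> and \<open>q = 1\<close>, then \<open>M\<close> is the
    line through \<open>e 0\<close>, and \<open>x\<close> may be zero.\<close>
  define y where "y = (if r = 0 \<and> q = 1 then e 0 else x)"
  let ?Y = "cspan (range (\<lambda>i. (T ^^ (2 * i)) y))"
  have y: "y \<in> M" using x assms(4) by (auto simp: y_def)
  have orbit: "(T ^^ (2 * i)) y \<in> ?Y" for i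
    by (intro complex_vector.span_base) auto
  have "?Y \<subseteq> M"
    using assms y funpow_mem by (intro complex_vector.span_minimal) auto
  moreover have "M \<subseteq> ?Y"
  proof -
    have "e 0 \<in> ?Y" if "q = 1"
    proof (cases "r = 0")
      case True
      then show ?thesis using orbit[of 0] that by (simp add: y_def)
    next
      case False
      have yk: "y \<in> M_space e k" using y assms(2) by auto
      \<comment> \<open>With \<open>q = 1\<close> the degree of \<open>x\<close> is
        \<open>2 * r\<close>, so after \<open>2 * r\<close> shifts only coordinate \<open>0\<close>
        survives. The subspace is now the span \<open>?Y\<close> of the orbit, and
        \<open>d = 0\<close>.\<close>
      show ?thesis
      proof (rule basis_vector_mem[where y = "(T ^^ (2 * r)) y"])
        show "?Y \<subseteq> M_space e k" using \<open>?Y \<subseteq> M\<close> assms(2) by simp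
        show "coord ((T ^^ (2 * r)) y) 0 \<noteq> 0"
          using lead False that yk by (simp add: T_funpow y_def)
        show "coord ((T ^^ (2 * r)) y) i = 0" if "i > 0" for i
          using top False \<open>q = 1\<close> that yk by (simp add: T_funpow y_def)
      qed (use orbit in auto)
    qed
    moreover have "(T ^^ (2 * i)) x \<in> ?Y" if "i < r" for i
      using orbit[of i] that by (auto simp: y_def)
    ultimately show ?thesis
      unfolding M using assms(6) by (intro complex_vector.span_minimal) (auto simp: le_Suc_eq)
  qed
  ultimately show ?thesis using y unfolding cyclic_subspace_def by blast
qed

end

theorem theorem2p5:
  fixes e :: "nat \<Rightarrow> 'h :: complex_hilbert_space"
    and T :: "'h \<Rightarrow> 'h"
    and M :: "'h set"
    and k n :: nat
  assumes "orthonormal_basis e"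
    and "backward_shift_on e k T"
    and "csubspace M"
    and "M \<subseteq> M_space e k"
    and "cdim M = n"
    and "(T ^^ 2) ` M \<subseteq> M"
    and "\<not> cyclic_subspace T M"
  shows "\<exists>p :: int. - 1 \<le> p \<and> p \<le> int n - 3 \<and>
    (\<exists>x \<in> M. cinner x (e (nat (int n + p))) \<noteq> 0 \<and>
      M = cspan ({e i | i. int i \<le> int n - p - 2} \<union> {(T ^^ (2 * i)) x | i. int i \<le> p}))"
proof -
  interpret backward_shift e T k
    using assms(1,2) by unfold_locales (auto simp: orthonormal_basis_def)
  \<comment> \<open>This guarantees that the least index \<open>q\<close> below exists.\<close>
  have "e (Suc k) \<notin> M"
    using coord_eq_0_of_gt[of "e (Suc k)" "Suc k"] assms(4) by (auto simp: orthonormal)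
  define q where "q = (LEAST q. e q \<notin> M)"
  have q: "e q \<notin> M" unfolding q_def using \<open>e (Suc k) \<notin> M\<close> by (rule LeastI)
  have below: "e ` {..<q} \<subseteq> M" using not_less_Least unfolding q_def by blast
  \<comment> \<open>Non-cyclicity enters here; it becomes the bound \<open>p \<le> n - 3\<close>, as
    \<open>n - 3 - p = q - 2\<close>.\<close>
  have "q \<ge> 2"
    using cyclic_of_small_gap[OF assms(3,4,6) below q] assms(7) by linarith
  obtain x r where x: "x \<in> M" and lead: "r > 0 \<Longrightarrow> coord x (q + 2 * r - 1) \<noteq> 0"
    and M: "M = cspan (e ` {..<q} \<union> (\<lambda>i. (T ^^ (2 * i)) x) ` {..<r})"
    and dim: "cdim M = q + r"
    using invariant_subspace_structure[OF assms(3,4,6) below q] by metis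
  have n: "n = q + r" using dim assms(5) by simp
  \<comment> \<open>This choice gives \<open>n - p - 2 = q - 1\<close> and
    \<open>n + p = q + 2 * r - 1\<close>.\<close>
  define p where "p = int r - 1"
  \<comment> \<open>For \<open>r = 0\<close>, that is \<open>p = -1\<close>, the list of shifts is
    empty, and the witness only has to have a nonzero coordinate at \<open>n + p = q - 1\<close>,
    which is not known of \<open>x\<close>.\<close>
  define y where "y = (if r = 0 then e (q - 1) else x)"
  have "y \<in> M" using x below \<open>q \<ge> 2\<close> by (auto simp: y_def)
  moreover have "nat (int n + p) = q + 2 * r - 1" using n \<open>q \<ge> 2\<close> by (simp add: p_def)
  then have "cinner y (e (nat (int n + p))) \<noteq> 0"
    using lead by (auto simp: y_def orthonormal)
  moreover have "{e i | i. int i \<le> int n - p - 2} = e ` {..<q}"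
    using n by (auto simp: p_def)
  moreover have "{(T ^^ (2 * i)) y | i. int i \<le> p} = (\<lambda>i. (T ^^ (2 * i)) x) ` {..<r}"
    by (auto simp: p_def y_def)
  ultimately have "y \<in> M \<and> cinner y (e (nat (int n + p))) \<noteq> 0 \<and>
      M = cspan ({e i | i. int i \<le> int n - p - 2} \<union> {(T ^^ (2 * i)) y | i. int i \<le> p})"
    using M by simp
  moreover have "- 1 \<le> p" "p \<le> int n - 3" using n \<open>q \<ge> 2\<close> by (auto simp: p_def)
  ultimately show ?thesis by blast
qed

end
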